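(* Let $(G,\tau)$ be a Hausdorff $\omega$-narrow first-countable SIN paratopological group. Then there exists a continuous isomorphism of $G$ onto a Tychonoff second-countable topological group.
   Context: A paratopological group is a group $G$ with a topology such that the product map $G\times G\to G$ is jointly continuous; it is a topological group if moreover inversion is continuous. $G$ is $\omega$-narrow if for each neighborhood $U$ of the neutral element of $G$ there is a countable subset $F$ of $G$ such that $G\subset FU\cap UF$. A paratopological group $G$ with a base $\mathscr{B}$ at the neutral element is a SIN group (Small Invariant Neighborhoods) if for each $U\in\mathscr{B}$ there exists $V\in\mathscr{B}$ such that $xVx^{-1}\subset U$ for each $x\in G$. A continuous isomorphism is a continuous bijective group homomorphism (its inverse need not be continuous). *)

theory Defs
  imports "HOL-Analysis.Analysis" "HOL-Algebra.Coset"
begin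

locale paratopological_group = group G for G (structure) +
  fixes \<tau> :: "'a topology"
  assumes topspace_eq_carrier: "topspace \<tau> = carrier G"
    and continuous_mult: "continuous_map (prod_topology \<tau> \<tau>) \<tau> (\<lambda>(x, y). x \<otimes> y)"

locale topological_group = paratopological_group +
  assumes continuous_inv: "continuous_map \<tau> \<tau> (\<lambda>x. inv\<^bsub>G\<^esub> x)"

text \<open>Neighborhoods are taken to be open, as in the library's \<^const>\<open>first_countable\<close>.
  Since every neighborhood contains an open one, admitting non-open neighborhoods below
  would not change any of the notions.\<close>

definition omega_narrow :: "('a, 'b) monoid_scheme \<Rightarrow> 'a topology \<Rightarrow> bool" where
  "omega_narrow G \<tau> \<longleftrightarrow>
    (\<forall>U. openin \<tau> U \<and> \<one>\<^bsub>G\<^esub> \<in> U \<longrightarrow>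
      (\<exists>F. F \<subseteq> carrier G \<and> countable F \<and>
        carrier G \<subseteq> (F <#>\<^bsub>G\<^esub> U) \<inter> (U <#>\<^bsub>G\<^esub> F)))"

definition open_base_at :: "'a topology \<Rightarrow> 'a \<Rightarrow> 'a set set \<Rightarrow> bool" where
  "open_base_at \<tau> x \<B> \<longleftrightarrow>
    (\<forall>V\<in>\<B>. openin \<tau> V \<and> x \<in> V) \<and>
    (\<forall>U. openin \<tau> U \<and> x \<in> U \<longrightarrow> (\<exists>V\<in>\<B>. V \<subseteq> U))"

definition small_invariant_base :: "('a, 'b) monoid_scheme \<Rightarrow> 'a set set \<Rightarrow> bool" where
  "small_invariant_base G \<B> \<longleftrightarrow>
    (\<forall>U\<in>\<B>. \<exists>V\<in>\<B>. \<forall>x\<in>carrier G. (\<lambda>v. x \<otimes>\<^bsub>G\<^esub> v \<otimes>\<^bsub>G\<^esub> inv\<^bsub>G\<^esub> x) ` V \<subseteq> U)"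

text \<open>The SIN condition does not depend on the chosen base at the neutral element, so
  quantifying the base existentially in the definition of a SIN group is harmless.\<close>

lemma small_invariant_base_cong:
  assumes "open_base_at \<tau> \<one>\<^bsub>G\<^esub> \<B>" "open_base_at \<tau> \<one>\<^bsub>G\<^esub> \<C>"
  shows "small_invariant_base G \<B> \<longleftrightarrow> small_invariant_base G \<C>"
proof -
  have "small_invariant_base G \<D>"
    if b: "open_base_at \<tau> \<one>\<^bsub>G\<^esub> \<E>" and d: "open_base_at \<tau> \<one>\<^bsub>G\<^esub> \<D>"
      and s: "small_invariant_base G \<E>" for \<D> \<E>
    unfolding small_invariant_base_def
  proof
    fix U assume "U \<in> \<D>"
    with b d obtain U' where U': "U' \<in> \<E>" "U' \<subseteq> U"
      unfolding open_base_at_def by meson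
    with s obtain V' where V': "V' \<in> \<E>"
      "\<forall>x\<in>carrier G. (\<lambda>v. x \<otimes>\<^bsub>G\<^esub> v \<otimes>\<^bsub>G\<^esub> inv\<^bsub>G\<^esub> x) ` V' \<subseteq> U'"
      unfolding small_invariant_base_def by meson
    with b d obtain V where V: "V \<in> \<D>" "V \<subseteq> V'"
      unfolding open_base_at_def by meson
    then show "\<exists>V\<in>\<D>. \<forall>x\<in>carrier G. (\<lambda>v. x \<otimes>\<^bsub>G\<^esub> v \<otimes>\<^bsub>G\<^esub> inv\<^bsub>G\<^esub> x) ` V \<subseteq> U"
      using V' U' by (intro bexI[of _ V]) blast+
  qed
  with assms show ?thesis by blast
qed

definition SIN_group :: "('a, 'b) monoid_scheme \<Rightarrow> 'a topology \<Rightarrow> bool" where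
  "SIN_group G \<tau> \<longleftrightarrow>
    (\<exists>\<B>. open_base_at \<tau> \<one>\<^bsub>G\<^esub> \<B> \<and> small_invariant_base G \<B>)"

definition Tychonoff_space :: "'a topology \<Rightarrow> bool" where
  "Tychonoff_space X \<longleftrightarrow> t1_space X \<and> completely_regular_space X"

definition continuous_isomorphism ::
    "('a, 'c) monoid_scheme \<Rightarrow> 'a topology \<Rightarrow> ('b, 'd) monoid_scheme \<Rightarrow> 'b topology \<Rightarrow> ('a \<Rightarrow> 'b) \<Rightarrow> bool" where
  "continuous_isomorphism G \<tau> H \<sigma> \<phi> \<longleftrightarrow> \<phi> \<in> iso G H \<and> continuous_map \<tau> \<sigma> \<phi>"

end

theory Submission
  imports Defs
begin

text \<open>The sets \<open>U U\<^sup>-\<^sup>1\<close>, for \<open>U\<close> in a countable base at the unit, form a base at the unit of a coarser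
  group topology: if \<open>V\<close> is a neighborhood such that \<open>V W \<subseteq> U\<close> for a neighborhood \<open>W \<supseteq> V\<close> containing
  all conjugates of \<open>V\<close>, then rewriting \<open>b\<^sup>-\<^sup>1 d\<close> as \<open>(b\<^sup>-\<^sup>1 d b) b\<^sup>-\<^sup>1\<close> yields
  \<open>V V\<^sup>-\<^sup>1 V V\<^sup>-\<^sup>1 \<subseteq> U U\<^sup>-\<^sup>1\<close>. Since \<open>\<tau>\<close> is Hausdorff, these sets meet only in the unit, so that the new
  topology is \<open>T\<^sub>1\<close>; a first-countable \<open>\<omega>\<close>-narrow topological group is second countable, and being
  regular it is then normal.\<close>

context group
begin

text \<open>Rewriting with \<open>m_assoc\<close> nests products to the right and hides adjacent
  inverse pairs; these two rules let the simplifier cancel them anyway.\<close>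

lemma inv_mult_cancel_left: "x \<in> carrier G \<Longrightarrow> y \<in> carrier G \<Longrightarrow> inv x \<otimes> (x \<otimes> y) = y"
  by (simp add: m_assoc[symmetric])

lemma mult_inv_cancel_left: "x \<in> carrier G \<Longrightarrow> y \<in> carrier G \<Longrightarrow> x \<otimes> (inv x \<otimes> y) = y"
  by (simp add: m_assoc[symmetric])

end

section \<open>Group topologies generated by a neighborhood base at the unit\<close>

text \<open>The classical axioms for a base at the unit of a group topology, with product and
  inverse merged into \<open>base_div\<close>. Members need not be open in the generated topology,
  so the sets \<open>U U\<^sup>-\<^sup>1\<close> can be supplied as they are.\<close>

locale group_nbhd_base = group G for G (structure) +
  fixes \<N> :: "'a set set"
  assumes base_nonempty: "\<N> \<noteq> {}"
    and base_subset: "U \<in> \<N> \<Longrightarrow> U \<subseteq> carrier G"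
    and base_one: "U \<in> \<N> \<Longrightarrow> \<one> \<in> U"
    and base_directed: "U \<in> \<N> \<Longrightarrow> V \<in> \<N> \<Longrightarrow> \<exists>W\<in>\<N>. W \<subseteq> U \<inter> V"
    and base_div: "U \<in> \<N> \<Longrightarrow> \<exists>V\<in>\<N>. \<forall>v\<in>V. \<forall>w\<in>V. v \<otimes> inv w \<in> U"
    and base_conj: "U \<in> \<N> \<Longrightarrow> x \<in> carrier G \<Longrightarrow> \<exists>V\<in>\<N>. \<forall>v\<in>V. x \<otimes> v \<otimes> inv x \<in> U"
begin

lemma base_carrier: "U \<in> \<N> \<Longrightarrow> u \<in> U \<Longrightarrow> u \<in> carrier G"
  using base_subset by blast

lemma base_inv:
  assumes "U \<in> \<N>"
  obtains V where "V \<in> \<N>" "\<And>v. v \<in> V \<Longrightarrow> inv v \<in> U"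
proof -
  obtain V where V: "V \<in> \<N>" "\<forall>v\<in>V. \<forall>w\<in>V. v \<otimes> inv w \<in> U"
    using base_div[OF assms] by blast
  have "inv w \<in> U" if "w \<in> V" for w
  proof -
    have "\<one> \<otimes> inv w \<in> U" using V base_one that by blast
    then show ?thesis using V(1) base_carrier that by simp
  qed
  with V(1) that show ?thesis by blast
qed

text \<open>Write \<open>v \<otimes> w\<close> as \<open>v \<otimes> inv (inv w)\<close> and combine
  \<open>base_div\<close> with \<open>base_inv\<close>.\<close>

lemma base_mult:
  assumes "U \<in> \<N>"
  obtains V where "V \<in> \<N>" "\<And>v w. v \<in> V \<Longrightarrow> w \<in> V \<Longrightarrow> v \<otimes> w \<in> U"
proof -
  obtain V where V: "V \<in> \<N>" "\<forall>v\<in>V. \<forall>w\<in>V. v \<otimes> inv w \<in> U"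
    using base_div[OF assms] by blast
  obtain V' where V': "V' \<in> \<N>" "\<And>v. v \<in> V' \<Longrightarrow> inv v \<in> V"
    using base_inv[OF V(1)] by blast
  obtain W where W: "W \<in> \<N>" "W \<subseteq> V \<inter> V'"
    using base_directed[OF V(1) V'(1)] by blast
  have "v \<otimes> w \<in> U" if "v \<in> W" "w \<in> W" for v w
  proof -
    have "v \<otimes> inv (inv w) \<in> U" using V(2) V'(2) W(2) that by blast
    then show ?thesis using base_carrier[OF W(1) that(2)] by simp
  qed
  with W(1) that show ?thesis by blast
qed

lemma base_ldiv:
  assumes "U \<in> \<N>"
  obtains V where "V \<in> \<N>" "\<And>v w. v \<in> V \<Longrightarrow> w \<in> V \<Longrightarrow> inv v \<otimes> w \<in> U"
proof -
  obtain V where V: "V \<in> \<N>" "\<And>v w. v \<in> V \<Longrightarrow> w \<in> V \<Longrightarrow> v \<otimes> w \<in> U"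
    using base_mult[OF assms] by blast
  obtain V' where V': "V' \<in> \<N>" "\<And>v. v \<in> V' \<Longrightarrow> inv v \<in> V"
    using base_inv[OF V(1)] by blast
  obtain W where W: "W \<in> \<N>" "W \<subseteq> V \<inter> V'"
    using base_directed[OF V(1) V'(1)] by blast
  then have "inv v \<otimes> w \<in> U" if "v \<in> W" "w \<in> W" for v w
    using V(2) V'(2) that by blast
  with W(1) that show ?thesis by blast
qed

text \<open>Openness is tested pointwise by left translates \<open>x U\<close>, because the members
  of \<open>\<N>\<close> may fail to be open themselves. Binary intersections work by
  \<open>base_directed\<close>.\<close>

definition base_topology :: "'a topology" where
  "base_topology = topology (\<lambda>A. A \<subseteq> carrier G \<and> (\<forall>x\<in>A. \<exists>U\<in>\<N>. \<forall>u\<in>U. x \<otimes> u \<in> A))"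

lemma openin_base_topology:
  "openin base_topology A \<longleftrightarrow> A \<subseteq> carrier G \<and> (\<forall>x\<in>A. \<exists>U\<in>\<N>. \<forall>u\<in>U. x \<otimes> u \<in> A)"
proof -
  have "istopology (\<lambda>A. A \<subseteq> carrier G \<and> (\<forall>x\<in>A. \<exists>U\<in>\<N>. \<forall>u\<in>U. x \<otimes> u \<in> A))"
    unfolding istopology_def
  proof (intro conjI allI impI)
    fix S T
    assume S: "S \<subseteq> carrier G \<and> (\<forall>x\<in>S. \<exists>U\<in>\<N>. \<forall>u\<in>U. x \<otimes> u \<in> S)"
      and T: "T \<subseteq> carrier G \<and> (\<forall>x\<in>T. \<exists>U\<in>\<N>. \<forall>u\<in>U. x \<otimes> u \<in> T)"
    show "S \<inter> T \<subseteq> carrier G" using S by blast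
    show "\<forall>x\<in>S \<inter> T. \<exists>U\<in>\<N>. \<forall>u\<in>U. x \<otimes> u \<in> S \<inter> T"
    proof
      fix x assume "x \<in> S \<inter> T"
      with S T obtain U V where "U \<in> \<N>" "\<forall>u\<in>U. x \<otimes> u \<in> S" "V \<in> \<N>" "\<forall>u\<in>V. x \<otimes> u \<in> T"
        by blast
      moreover from this obtain W where "W \<in> \<N>" "W \<subseteq> U \<inter> V" using base_directed by blast
      ultimately show "\<exists>U\<in>\<N>. \<forall>u\<in>U. x \<otimes> u \<in> S \<inter> T" by blast
    qed
  next
    fix \<K> assume K: "\<forall>A\<in>\<K>. A \<subseteq> carrier G \<and> (\<forall>x\<in>A. \<exists>U\<in>\<N>. \<forall>u\<in>U. x \<otimes> u \<in> A)"
    then show "\<Union>\<K> \<subseteq> carrier G" by blast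
    show "\<forall>x\<in>\<Union>\<K>. \<exists>U\<in>\<N>. \<forall>u\<in>U. x \<otimes> u \<in> \<Union>\<K>"
    proof
      fix x assume "x \<in> \<Union>\<K>"
      then obtain A where A: "A \<in> \<K>" "x \<in> A" by blast
      with K obtain U where "U \<in> \<N>" "\<forall>u\<in>U. x \<otimes> u \<in> A" by blast
      with A show "\<exists>U\<in>\<N>. \<forall>u\<in>U. x \<otimes> u \<in> \<Union>\<K>" by blast
    qed
  qed
  then show ?thesis by (simp add: base_topology_def)
qed

lemma topspace_base_topology: "topspace base_topology = carrier G"
proof -
  obtain U where "U \<in> \<N>" using base_nonempty by blast
  then have "\<exists>U\<in>\<N>. \<forall>u\<in>U. x \<otimes> u \<in> carrier G" if "x \<in> carrier G" for x
    using base_carrier that by blast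
  then have "openin base_topology (carrier G)" by (simp add: openin_base_topology)
  moreover have "topspace base_topology \<subseteq> carrier G"
    using openin_topspace[of base_topology] unfolding openin_base_topology by (rule conjunct1)
  ultimately show ?thesis
    using openin_subset by (intro equalityI)
qed

text \<open>The interior of the translate \<open>x U\<close> in \<open>base_topology\<close>; it
  serves as an open replacement for \<open>x U\<close>.\<close>

definition base_interior :: "'a \<Rightarrow> 'a set \<Rightarrow> 'a set" where
  "base_interior x U = {y \<in> carrier G. \<exists>V\<in>\<N>. \<forall>v\<in>V. y \<otimes> v \<in> (\<otimes>) x ` U}"

text \<open>If \<open>y V\<close> lies in \<open>x U\<close> and \<open>W W \<subseteq> V\<close>,
  then \<open>(y w) W\<close> lies in \<open>x U\<close> for every \<open>w\<close> in
  \<open>W\<close>.\<close>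

lemma openin_base_interior: "openin base_topology (base_interior x U)"
  unfolding openin_base_topology
proof (intro conjI ballI)
  show "base_interior x U \<subseteq> carrier G" by (auto simp: base_interior_def)
  fix y assume "y \<in> base_interior x U"
  then obtain V where y: "y \<in> carrier G" and V: "V \<in> \<N>" "\<forall>v\<in>V. y \<otimes> v \<in> (\<otimes>) x ` U"
    by (auto simp: base_interior_def)
  obtain W where W: "W \<in> \<N>" "\<And>v w. v \<in> W \<Longrightarrow> w \<in> W \<Longrightarrow> v \<otimes> w \<in> V"
    using base_mult[OF V(1)] by blast
  have "y \<otimes> w \<in> base_interior x U" if w: "w \<in> W" for w
  proof -
    have "(y \<otimes> w) \<otimes> v \<in> (\<otimes>) x ` U" if "v \<in> W" for v
      using V(2) W(2)[OF w that] y w that base_carrier[OF W(1)] by (metis m_assoc)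
    then show ?thesis
      using y w base_carrier W(1) by (auto simp: base_interior_def)
  qed
  with W(1) show "\<exists>W\<in>\<N>. \<forall>w\<in>W. y \<otimes> w \<in> base_interior x U" by blast
qed

lemma base_interior_subset: "base_interior x U \<subseteq> (\<otimes>) x ` U"
  using base_one by (fastforce simp: base_interior_def)

lemma in_base_interior: "x \<in> carrier G \<Longrightarrow> U \<in> \<N> \<Longrightarrow> x \<in> base_interior x U"
  by (auto simp: base_interior_def)

text \<open>Moving \<open>y\<close> to the left gives
  \<open>(x w)(y v) = x y (y\<^sup>-\<^sup>1 w y) v\<close>, so \<open>base_conj\<close> at
  \<open>inv y\<close> absorbs the lack of commutativity and \<open>base_mult\<close> does the
  rest.\<close>

lemma continuous_map_mult_base_topology:
  "continuous_map (prod_topology base_topology base_topology) base_topology (\<lambda>(x, y). x \<otimes> y)"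
  unfolding continuous_map_def
proof (intro conjI allI impI)
  show "(\<lambda>(x, y). x \<otimes> y) \<in> topspace (prod_topology base_topology base_topology) \<rightarrow> topspace base_topology"
    by (auto simp: topspace_base_topology)
  fix A assume A: "openin base_topology A"
  show "openin (prod_topology base_topology base_topology)
     {p \<in> topspace (prod_topology base_topology base_topology). (case p of (x, y) \<Rightarrow> x \<otimes> y) \<in> A}"
    unfolding openin_prod_topology_alt
  proof (intro allI impI)
    fix x y
    assume "(x, y) \<in> {p \<in> topspace (prod_topology base_topology base_topology).
      (case p of (x, y) \<Rightarrow> x \<otimes> y) \<in> A}"
    then have x: "x \<in> carrier G" and y: "y \<in> carrier G" and xy: "x \<otimes> y \<in> A"
      by (auto simp: topspace_base_topology)
    obtain U where U: "U \<in> \<N>" "\<forall>u\<in>U. (x \<otimes> y) \<otimes> u \<in> A"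
      using A xy by (auto simp: openin_base_topology)
    obtain V where V: "V \<in> \<N>" "\<And>v w. v \<in> V \<Longrightarrow> w \<in> V \<Longrightarrow> v \<otimes> w \<in> U"
      using base_mult[OF U(1)] by blast
    obtain W where W: "W \<in> \<N>" "\<forall>w\<in>W. inv y \<otimes> w \<otimes> inv (inv y) \<in> V"
      using base_conj[OF V(1)] y by blast
    have prod: "(x \<otimes> w) \<otimes> (y \<otimes> v) \<in> A" if w: "w \<in> W" and v: "v \<in> V" for w v
    proof -
      have c: "w \<in> carrier G" "v \<in> carrier G" using w v W(1) V(1) base_carrier by auto
      have "(x \<otimes> y) \<otimes> ((inv y \<otimes> w \<otimes> inv (inv y)) \<otimes> v) \<in> A"
        using U(2) V(2) W(2) w v by blast
      also have "(x \<otimes> y) \<otimes> ((inv y \<otimes> w \<otimes> inv (inv y)) \<otimes> v) = (x \<otimes> w) \<otimes> (y \<otimes> v)"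
        using x y c by (simp add: m_assoc mult_inv_cancel_left)
      finally show ?thesis .
    qed
    show "\<exists>S T. openin base_topology S \<and> openin base_topology T \<and> x \<in> S \<and> y \<in> T \<and>
        S \<times> T \<subseteq> {p \<in> topspace (prod_topology base_topology base_topology).
          (case p of (x, y) \<Rightarrow> x \<otimes> y) \<in> A}"
    proof (intro exI conjI)
      show "base_interior x W \<times> base_interior y V \<subseteq>
          {p \<in> topspace (prod_topology base_topology base_topology). (case p of (x, y) \<Rightarrow> x \<otimes> y) \<in> A}"
        using base_interior_subset[of x W] base_interior_subset[of y V] prod
        by (force simp: topspace_base_topology base_interior_def)
    qed (use x y V(1) W(1) in \<open>auto simp: openin_base_interior in_base_interior\<close>)
  qed
qed

text \<open>The identity \<open>(x w)\<^sup>-\<^sup>1 = x\<^sup>-\<^sup>1 (x w\<^sup>-\<^sup>1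
  x\<^sup>-\<^sup>1)\<close> turns the claim into \<open>base_conj\<close> at \<open>x\<close>
  followed by \<open>base_inv\<close>.\<close>

lemma continuous_map_inv_base_topology: "continuous_map base_topology base_topology (\<lambda>x. inv x)"
  unfolding continuous_map_def
proof (intro conjI allI impI)
  show "(\<lambda>x. inv x) \<in> topspace base_topology \<rightarrow> topspace base_topology"
    by (auto simp: topspace_base_topology)
  fix A assume A: "openin base_topology A"
  show "openin base_topology {x \<in> topspace base_topology. inv x \<in> A}"
    unfolding openin_base_topology topspace_base_topology
  proof (intro conjI ballI)
    fix x assume "x \<in> {x \<in> carrier G. inv x \<in> A}"
    then have x: "x \<in> carrier G" "inv x \<in> A" by auto
    with A obtain U where U: "U \<in> \<N>" "\<forall>u\<in>U. inv x \<otimes> u \<in> A"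
      by (auto simp: openin_base_topology)
    obtain V where V: "V \<in> \<N>" "\<forall>v\<in>V. x \<otimes> v \<otimes> inv x \<in> U"
      using base_conj[OF U(1) x(1)] by blast
    obtain W where W: "W \<in> \<N>" "\<And>w. w \<in> W \<Longrightarrow> inv w \<in> V"
      using base_inv[OF V(1)] by blast
    have "x \<otimes> w \<in> {x \<in> carrier G. inv x \<in> A}" if w: "w \<in> W" for w
    proof -
      have c: "w \<in> carrier G" using w W(1) base_carrier by auto
      have "inv x \<otimes> (x \<otimes> inv w \<otimes> inv x) \<in> A" using U(2) V(2) W(2) w by blast
      also have "inv x \<otimes> (x \<otimes> inv w \<otimes> inv x) = inv (x \<otimes> w)"
        using x(1) c by (simp add: m_assoc inv_mult_group inv_mult_cancel_left)
      finally show ?thesis using x(1) c by simp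
    qed
    with W(1) show "\<exists>W\<in>\<N>. \<forall>w\<in>W. x \<otimes> w \<in> {x \<in> carrier G. inv x \<in> A}" by blast
  qed auto
qed

lemma topological_group_base_topology: "topological_group G base_topology"
  by unfold_locales
    (simp_all add: topspace_base_topology continuous_map_mult_base_topology
      continuous_map_inv_base_topology)

section \<open>Separation and countability of the generated topology\<close>

text \<open>Let \<open>a U\<close> miss \<open>C\<close> and let
  \<open>V V\<^sup>-\<^sup>1 \<subseteq> U\<close>. If \<open>a V\<close> met \<open>c V\<close>,
  say \<open>a v = c w\<close>, then \<open>c = a (v w\<^sup>-\<^sup>1)\<close> would lie in
  \<open>a U\<close>.\<close>

lemma regular_space_base_topology: "regular_space base_topology"
  unfolding regular_space_def
proof (intro allI impI)
  fix C a
  assume *: "closedin base_topology C \<and> a \<in> topspace base_topology - C"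
  then have C: "C \<subseteq> carrier G" and a: "a \<in> carrier G" "a \<notin> C"
    using closedin_subset[of base_topology C] by (simp_all add: topspace_base_topology)
  from * have "openin base_topology (topspace base_topology - C)" by blast
  with * obtain U where U: "U \<in> \<N>" "\<forall>u\<in>U. a \<otimes> u \<in> topspace base_topology - C"
    unfolding openin_base_topology by blast
  obtain V where V: "V \<in> \<N>" "\<forall>v\<in>V. \<forall>w\<in>V. v \<otimes> inv w \<in> U"
    using base_div[OF U(1)] by blast
  let ?T = "\<Union>c\<in>C. base_interior c V"
  have "False" if "y \<in> base_interior a V" "y \<in> base_interior c V" "c \<in> C" for y c
  proof -
    obtain v w where v: "v \<in> V" and w: "w \<in> V" and eq: "a \<otimes> v = c \<otimes> w"
      using \<open>y \<in> base_interior a V\<close> \<open>y \<in> base_interior c V\<close> base_interior_subset by blast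
    have "v \<in> carrier G" "w \<in> carrier G" "c \<in> carrier G"
      using v w V(1) base_carrier C \<open>c \<in> C\<close> by auto
    then have "a \<otimes> (v \<otimes> inv w) = c"
      using a(1) eq by (metis inv_closed inv_solve_right m_assoc m_closed)
    then show False using U(2) V(2) v w \<open>c \<in> C\<close> by blast
  qed
  then have "disjnt (base_interior a V) ?T" unfolding disjnt_iff by blast
  moreover have "C \<subseteq> ?T" using in_base_interior C V(1) by blast
  ultimately show "\<exists>S T. openin base_topology S \<and> openin base_topology T \<and> a \<in> S \<and> C \<subseteq> T \<and> disjnt S T"
    using in_base_interior[OF a(1) V(1)]
    by (intro exI[of _ "base_interior a V"] exI[of _ ?T]) (auto simp: openin_base_interior)
qed

text \<open>Translation reduces a pair \<open>x\<close>, \<open>y\<close> to the unit and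
  \<open>inv x \<otimes> y\<close>: a member that omits the latter gives a translate at
  \<open>x\<close> that omits \<open>y\<close>.\<close>

lemma t1_space_base_topology:
  assumes "\<And>x. x \<in> carrier G \<Longrightarrow> x \<noteq> \<one> \<Longrightarrow> \<exists>U\<in>\<N>. x \<notin> U"
  shows "t1_space base_topology"
  unfolding t1_space_def topspace_base_topology
proof (intro ballI impI)
  fix x y assume x: "x \<in> carrier G" and y: "y \<in> carrier G" and "x \<noteq> y"
  then have "inv x \<otimes> y \<noteq> \<one>" by (simp add: inv_solve_left')
  then obtain U where U: "U \<in> \<N>" "inv x \<otimes> y \<notin> U"
    using assms x y by blast
  have "y \<notin> base_interior x U"
  proof
    assume "y \<in> base_interior x U"
    then obtain u where "u \<in> U" "y = x \<otimes> u" using base_interior_subset by blast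
    then show False using U x base_carrier by (metis inv_solve_left m_closed)
  qed
  then show "\<exists>A. openin base_topology A \<and> x \<in> A \<and> y \<notin> A"
    using openin_base_interior[of x U] in_base_interior[OF x U(1)] by auto
qed

text \<open>Let \<open>y = x w\<close> with \<open>w\<close> in \<open>W\<close> and
  \<open>W W \<subseteq> V\<close>. Then \<open>y W \<subseteq> x V\<close>, so \<open>y\<close> is
  interior to \<open>x V\<close>; and \<open>x V = y w\<^sup>-\<^sup>1 V\<close> stays inside
  \<open>y U\<close> once \<open>V\<^sup>-\<^sup>1 V \<subseteq> U\<close>.\<close>

lemma second_countable_base_topology:
  assumes "countable \<N>"
    and narrow: "\<And>U. U \<in> \<N> \<Longrightarrow> \<exists>F. F \<subseteq> carrier G \<and> countable F \<and> carrier G \<subseteq> F <#> U"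
  shows "second_countable base_topology"
proof -
  obtain F where F: "\<And>U. U \<in> \<N> \<Longrightarrow> F U \<subseteq> carrier G" "\<And>U. U \<in> \<N> \<Longrightarrow> countable (F U)"
    "\<And>U. U \<in> \<N> \<Longrightarrow> carrier G \<subseteq> F U <#> U"
    using narrow by metis
  \<comment> \<open>The two indices are independent: a basic set is the interior of a translate of
    one member, while its center comes from the countable set of another, finer one.\<close>
  let ?B = "\<Union>U\<in>\<N>. \<Union>V\<in>\<N>. (\<lambda>x. base_interior x U) ` F V"
  show ?thesis
    unfolding second_countable_def
  proof (intro exI[of _ ?B] conjI allI impI)
    show "countable ?B" using assms(1) F(2) by auto
    show "\<forall>V\<in>?B. openin base_topology V" by (auto simp: openin_base_interior)
    fix A y assume A: "openin base_topology A \<and> y \<in> A"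
    then have y: "y \<in> carrier G" by (auto simp: openin_base_topology)
    obtain U where U: "U \<in> \<N>" "\<forall>u\<in>U. y \<otimes> u \<in> A" using A by (auto simp: openin_base_topology)
    obtain V where V: "V \<in> \<N>" "\<And>v w. v \<in> V \<Longrightarrow> w \<in> V \<Longrightarrow> inv v \<otimes> w \<in> U"
      using base_ldiv[OF U(1)] by blast
    obtain W where W: "W \<in> \<N>" "\<And>v w. v \<in> W \<Longrightarrow> w \<in> W \<Longrightarrow> v \<otimes> w \<in> V"
      using base_mult[OF V(1)] by blast
    obtain x w where x: "x \<in> F W" and w: "w \<in> W" and yxw: "y = x \<otimes> w"
      using F(3)[OF W(1)] y by (auto simp: set_mult_def)
    have xc: "x \<in> carrier G" and wc: "w \<in> carrier G"
      using x w F(1) W(1) base_carrier by auto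
    have "w \<otimes> \<one> \<in> V" using W w base_one by blast
    then have wV: "w \<in> V" using wc by simp
    have "y \<otimes> v \<in> (\<otimes>) x ` V" if "v \<in> W" for v
      using W(2)[OF w that] base_carrier[OF W(1) that] xc wc yxw by (simp add: m_assoc)
    then have "y \<in> base_interior x V"
      using y W(1) by (auto simp: base_interior_def)
    moreover have "base_interior x V \<subseteq> A"
    proof
      fix z assume "z \<in> base_interior x V"
      then obtain v where v: "v \<in> V" "z = x \<otimes> v" using base_interior_subset by blast
      have vc: "v \<in> carrier G" using v V(1) base_carrier by auto
      have "z = y \<otimes> (inv w \<otimes> v)"
        using xc wc vc v(2) yxw by (simp add: m_assoc mult_inv_cancel_left)
      then show "z \<in> A" using U(2) V(2)[OF wV v(1)] by simp
    qed
    ultimately show "\<exists>B\<in>?B. y \<in> B \<and> B \<subseteq> A" using V(1) W(1) x by blast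
  qed
qed

end

section \<open>The coarser group topology on a SIN paratopological group\<close>

context paratopological_group
begin

text \<open>Fixing the first argument of the jointly continuous product makes left translations
  continuous. The set shown open is the translate \<open>x\<^sup>-\<^sup>1 U\<close>.\<close>

lemma openin_left_translate_vimage:
  assumes "openin \<tau> U" "x \<in> carrier G"
  shows "openin \<tau> {y \<in> carrier G. x \<otimes> y \<in> U}"
proof -
  have "continuous_map \<tau> (prod_topology \<tau> \<tau>) (\<lambda>y. (x, y))"
    using assms(2) topspace_eq_carrier by (simp add: continuous_map_pairwise o_def)
  then have "continuous_map \<tau> \<tau> (\<lambda>y. x \<otimes> y)"
    using continuous_map_compose[OF _ continuous_mult] by (fastforce simp: o_def)
  from openin_continuous_map_preimage[OF this assms(1)] show ?thesis
    by (simp add: topspace_eq_carrier)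
qed

lemma nbhd_one_mult:
  assumes "openin \<tau> U" "\<one> \<in> U"
  obtains V where "openin \<tau> V" "\<one> \<in> V" "\<And>v w. v \<in> V \<Longrightarrow> w \<in> V \<Longrightarrow> v \<otimes> w \<in> U"
proof -
  have "openin (prod_topology \<tau> \<tau>) {p \<in> topspace (prod_topology \<tau> \<tau>). (case p of (x, y) \<Rightarrow> x \<otimes> y) \<in> U}"
    using openin_continuous_map_preimage[OF continuous_mult assms(1)] .
  moreover have "(\<one>, \<one>) \<in> {p \<in> topspace (prod_topology \<tau> \<tau>). (case p of (x, y) \<Rightarrow> x \<otimes> y) \<in> U}"
    using assms(2) topspace_eq_carrier by simp
  ultimately obtain S T where ST: "openin \<tau> S" "openin \<tau> T" "\<one> \<in> S" "\<one> \<in> T"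
    "S \<times> T \<subseteq> {p \<in> topspace (prod_topology \<tau> \<tau>). (case p of (x, y) \<Rightarrow> x \<otimes> y) \<in> U}"
    unfolding openin_prod_topology_alt by meson
  show ?thesis
    by (rule that[of "S \<inter> T"]) (use ST in auto)
qed

lemma open_base_at_oneD:
  assumes "open_base_at \<tau> \<one> \<B>" "U \<in> \<B>"
  shows "openin \<tau> U" "\<one> \<in> U" "U \<subseteq> carrier G"
  using assms openin_subset[of \<tau> U] by (auto simp: open_base_at_def topspace_eq_carrier)

text \<open>This is \<open>U U\<^sup>-\<^sup>1\<close>, which for
  \<open>U \<subseteq> carrier G\<close> is closed under inversion even when inversion is not
  continuous for \<open>\<tau>\<close>.\<close>

definition quotients :: "'a set \<Rightarrow> 'a set" where
  "quotients U = {u \<otimes> inv v | u v. u \<in> U \<and> v \<in> U}"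

lemma quotientsI: "u \<in> U \<Longrightarrow> v \<in> U \<Longrightarrow> u \<otimes> inv v \<in> quotients U"
  by (auto simp: quotients_def)

lemma quotients_mono: "U \<subseteq> V \<Longrightarrow> quotients U \<subseteq> quotients V"
  by (auto simp: quotients_def)

lemma subset_quotients:
  assumes "U \<subseteq> carrier G" "\<one> \<in> U"
  shows "U \<subseteq> quotients U"
proof
  fix u assume "u \<in> U"
  with assms have "u = u \<otimes> inv \<one>" by auto
  with quotientsI[OF \<open>u \<in> U\<close> assms(2)] show "u \<in> quotients U" by simp
qed

lemma group_nbhd_base_quotients:
  assumes base: "open_base_at \<tau> \<one> \<B>" and sin: "small_invariant_base G \<B>"
  shows "group_nbhd_base G (quotients ` \<B>)"
proof -
  note B = open_base_at_oneD[OF base]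
  have ex: "\<exists>V\<in>\<B>. V \<subseteq> U" if "openin \<tau> U" "\<one> \<in> U" for U
    using base that unfolding open_base_at_def by blast
  \<comment> \<open>The same \<open>V\<close> works for all \<open>x\<close>. This uniformity
    matters below, where the conjugating element itself ranges over a neighborhood.\<close>
  have conj: "\<exists>V\<in>\<B>. \<forall>x\<in>carrier G. \<forall>v\<in>V. x \<otimes> v \<otimes> inv x \<in> U" if "U \<in> \<B>" for U
    using sin that by (simp add: small_invariant_base_def image_subset_iff)
  show ?thesis
  proof unfold_locales
    show "quotients ` \<B> \<noteq> {}"
      using ex[of "carrier G"] openin_topspace[of \<tau>] topspace_eq_carrier by auto
    show "Q \<subseteq> carrier G" if Q: "Q \<in> quotients ` \<B>" for Q
    proof -
      obtain U where "U \<in> \<B>" "Q = quotients U" using Q by blast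
      then show ?thesis using B(3)[of U] by (auto simp: quotients_def)
    qed
    show "\<one> \<in> Q" if Q: "Q \<in> quotients ` \<B>" for Q
    proof -
      obtain U where U: "U \<in> \<B>" "Q = quotients U" using Q by blast
      then show ?thesis using subset_quotients[OF B(3,2)[OF U(1)]] B(2)[OF U(1)] by auto
    qed
  next
    fix P Q assume "P \<in> quotients ` \<B>" "Q \<in> quotients ` \<B>"
    then obtain U V where UV: "U \<in> \<B>" "P = quotients U" "V \<in> \<B>" "Q = quotients V" by blast
    then obtain W where "W \<in> \<B>" "W \<subseteq> U \<inter> V" using ex[of "U \<inter> V"] B(1,2) by auto
    then show "\<exists>R\<in>quotients ` \<B>. R \<subseteq> P \<inter> Q"
      using UV quotients_mono[of W U] quotients_mono[of W V] by auto
  next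
    fix Q assume "Q \<in> quotients ` \<B>"
    then obtain U where U: "U \<in> \<B>" "Q = quotients U" by blast
    obtain V where V: "openin \<tau> V" "\<one> \<in> V" "\<And>v w. v \<in> V \<Longrightarrow> w \<in> V \<Longrightarrow> v \<otimes> w \<in> U"
      using nbhd_one_mult[OF B(1,2)[OF U(1)]] by blast
    obtain V' where V': "V' \<in> \<B>" "V' \<subseteq> V" using ex V by blast
    obtain W where W: "W \<in> \<B>" "\<And>x w. x \<in> carrier G \<Longrightarrow> w \<in> W \<Longrightarrow> x \<otimes> w \<otimes> inv x \<in> V'"
      using conj V'(1) by blast
    \<comment> \<open>Conjugation by the unit shows that \<open>W\<close> itself lies in
      \<open>V\<close>.\<close>
    have WV: "w \<in> V" "w \<in> carrier G" if "w \<in> W" for w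
    proof -
      show "w \<in> carrier G" using B(3)[OF W(1)] that by blast
      then show "w \<in> V" using W(2)[OF one_closed that] V'(2) by auto
    qed
    have "x \<otimes> inv y \<in> Q" if xy: "x \<in> quotients W" "y \<in> quotients W" for x y
    proof -
      obtain a b c d where m: "a \<in> W" "b \<in> W" "c \<in> W" "d \<in> W"
        and eq: "x = a \<otimes> inv b" "y = c \<otimes> inv d"
        using xy by (auto simp: quotients_def)
      note c = WV(2)[OF m(1)] WV(2)[OF m(2)] WV(2)[OF m(3)] WV(2)[OF m(4)]
      \<comment> \<open>Moving \<open>b\<close> past \<open>d\<close> turns
        \<open>a b\<^sup>-\<^sup>1 d c\<^sup>-\<^sup>1\<close> into
        \<open>(a ?d)(c b)\<^sup>-\<^sup>1\<close>, whose two factors \<open>a ?d\<close> and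
        \<open>c b\<close> both lie in \<open>V V \<subseteq> U\<close>.\<close>
      let ?d = "inv b \<otimes> d \<otimes> inv (inv b)"
      have d: "?d \<in> V" using W(2)[OF inv_closed[OF c(2)] m(4)] V'(2) by auto
      have "(a \<otimes> ?d) \<otimes> inv (c \<otimes> b) = x \<otimes> inv y"
        using c by (simp add: m_assoc inv_mult_group mult_inv_cancel_left eq)
      then show ?thesis
        using quotientsI[OF V(3)[OF WV(1)[OF m(1)] d] V(3)[OF WV(1)[OF m(3)] WV(1)[OF m(2)]]] U(2)
        by argo
    qed
    with W(1) show "\<exists>R\<in>quotients ` \<B>. \<forall>x\<in>R. \<forall>y\<in>R. x \<otimes> inv y \<in> Q" by blast
  next
    fix Q x assume "Q \<in> quotients ` \<B>" and x: "x \<in> carrier G"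
    then obtain U where U: "U \<in> \<B>" "Q = quotients U" by blast
    obtain V where V: "V \<in> \<B>" "\<And>x v. x \<in> carrier G \<Longrightarrow> v \<in> V \<Longrightarrow> x \<otimes> v \<otimes> inv x \<in> U"
      using conj U(1) by blast
    have "x \<otimes> y \<otimes> inv x \<in> Q" if y: "y \<in> quotients V" for y
    proof -
      obtain a b where m: "a \<in> V" "b \<in> V" and eq: "y = a \<otimes> inv b"
        using y by (auto simp: quotients_def)
      have c: "a \<in> carrier G" "b \<in> carrier G" using m B(3)[OF V(1)] by auto
      \<comment> \<open>Conjugation is an automorphism, so it maps quotients of elements of
        \<open>V\<close> to quotients of their conjugates.\<close>
      have "(x \<otimes> a \<otimes> inv x) \<otimes> inv (x \<otimes> b \<otimes> inv x) = x \<otimes> y \<otimes> inv x"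
        using c x by (simp add: m_assoc inv_mult_group inv_mult_cancel_left eq)
      then show ?thesis
        using quotientsI[OF V(2)[OF x m(1)] V(2)[OF x m(2)]] U(2) by argo
    qed
    with V(1) show "\<exists>R\<in>quotients ` \<B>. \<forall>y\<in>R. x \<otimes> y \<otimes> inv x \<in> Q" by blast
  qed
qed

text \<open>Since \<open>U \<subseteq> U U\<^sup>-\<^sup>1\<close>, a set that contains
  \<open>x U U\<^sup>-\<^sup>1\<close> contains the \<open>\<tau>\<close>-open neighborhood
  \<open>x U\<close> of \<open>x\<close>.\<close>

lemma continuous_map_id_base_topology:
  assumes base: "open_base_at \<tau> \<one> \<B>" and N: "group_nbhd_base G (quotients ` \<B>)"
  shows "continuous_map \<tau> (group_nbhd_base.base_topology G (quotients ` \<B>)) id"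
proof -
  interpret N: group_nbhd_base G "quotients ` \<B>" by (rule N)
  have "openin \<tau> A" if A: "openin N.base_topology A" for A
  proof (subst openin_subopen, intro ballI)
    fix x assume "x \<in> A"
    with A obtain U where x: "x \<in> carrier G" and U: "U \<in> \<B>" "\<forall>u\<in>quotients U. x \<otimes> u \<in> A"
      unfolding N.openin_base_topology by blast
    note oU = open_base_at_oneD[OF base U(1)]
    \<comment> \<open>The translate \<open>x U\<close>, written as a preimage under translation by
      \<open>inv x\<close>.\<close>
    let ?T = "{y \<in> carrier G. inv x \<otimes> y \<in> U}"
    have "?T \<subseteq> A"
    proof
      fix y assume y: "y \<in> ?T"
      then have "x \<otimes> (inv x \<otimes> y) \<in> A" using U(2) subset_quotients[OF oU(3,2)] by blast
      then show "y \<in> A" using x y by (simp add: mult_inv_cancel_left)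
    qed
    moreover have "openin \<tau> ?T" using openin_left_translate_vimage oU(1) x by simp
    moreover have "x \<in> ?T" using x oU(2) by simp
    ultimately show "\<exists>T. openin \<tau> T \<and> x \<in> T \<and> T \<subseteq> A" by blast
  qed
  moreover have "{x \<in> topspace \<tau>. x \<in> A} = A" if "openin N.base_topology A" for A
    using openin_subset[OF that] by (auto simp: topspace_eq_carrier N.topspace_base_topology)
  ultimately show ?thesis
    by (simp add: continuous_map_def topspace_eq_carrier N.topspace_base_topology)
qed

text \<open>Membership \<open>x = u v\<^sup>-\<^sup>1\<close> means \<open>x v = u\<close>. If
  \<open>S\<close> and \<open>T\<close> separate \<open>x\<close> from the unit, a small
  \<open>U\<close> has \<open>x U \<subseteq> S\<close> and \<open>U \<subseteq> T\<close>, which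
  rules this out.\<close>

lemma Hausdorff_imp_quotients_separate:
  assumes base: "open_base_at \<tau> \<one> \<B>" and "Hausdorff_space \<tau>"
    and x: "x \<in> carrier G" "x \<noteq> \<one>"
  obtains U where "U \<in> \<B>" "x \<notin> quotients U"
proof -
  obtain S T where ST: "openin \<tau> S" "openin \<tau> T" "x \<in> S" "\<one> \<in> T" "disjnt S T"
    using assms(2) x topspace_eq_carrier unfolding Hausdorff_space_def by (metis one_closed)
  let ?W = "{y \<in> carrier G. x \<otimes> y \<in> S} \<inter> T"
  have "openin \<tau> ?W" using openin_left_translate_vimage ST x by blast
  moreover have "\<one> \<in> ?W" using ST x by simp
  ultimately obtain U where U: "U \<in> \<B>" "U \<subseteq> ?W"
    using base unfolding open_base_at_def by meson
  have "x \<notin> quotients U"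
  proof
    assume "x \<in> quotients U"
    then obtain u v where uv: "u \<in> U" "v \<in> U" "x = u \<otimes> inv v" by (auto simp: quotients_def)
    have c: "v \<in> carrier G" "x \<otimes> v \<in> S" and u: "u \<in> T" "u \<in> carrier G"
      using uv(1,2) U(2) by auto
    then have "x \<otimes> v = u" by (simp add: uv(3) m_assoc)
    then show False using c u ST(5) by (auto simp: disjnt_iff)
  qed
  with U(1) show ?thesis by (rule that)
qed

text \<open>The SIN property is known only for some base; \<open>small_invariant_base_cong\<close>
  moves it to the countable one.\<close>

lemma SIN_group_countable_base:
  assumes "first_countable \<tau>" "SIN_group G \<tau>"
  obtains \<B> where "countable \<B>" "open_base_at \<tau> \<one> \<B>" "small_invariant_base G \<B>"
proof -
  have "\<one> \<in> topspace \<tau>" by (simp add: topspace_eq_carrier)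
  then obtain \<C> where C: "countable \<C>" "\<forall>V\<in>\<C>. openin \<tau> V"
    "\<forall>U. openin \<tau> U \<and> \<one> \<in> U \<longrightarrow> (\<exists>V\<in>\<C>. \<one> \<in> V \<and> V \<subseteq> U)"
    using assms(1) unfolding first_countable_def by meson
  \<comment> \<open>The family from \<open>first_countable\<close> may contain open sets that omit
    the unit; these are discarded.\<close>
  let ?B = "{V \<in> \<C>. \<one> \<in> V}"
  have "open_base_at \<tau> \<one> ?B"
    using C unfolding open_base_at_def by blast
  moreover from this have "small_invariant_base G ?B"
    using assms(2) small_invariant_base_cong unfolding SIN_group_def by blast
  moreover have "countable ?B" using C(1) by simp
  ultimately show ?thesis using that by blast
qed

lemma coarser_second_countable_group_topology:
  assumes "Hausdorff_space \<tau>" "omega_narrow G \<tau>" "first_countable \<tau>" "SIN_group G \<tau>"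
  obtains \<sigma> where "topological_group G \<sigma>" "Tychonoff_space \<sigma>" "second_countable \<sigma>"
    "continuous_map \<tau> \<sigma> id"
proof -
  obtain \<B> where B: "countable \<B>" "open_base_at \<tau> \<one> \<B>" "small_invariant_base G \<B>"
    using SIN_group_countable_base assms(3,4) by blast
  have N: "group_nbhd_base G (quotients ` \<B>)"
    using group_nbhd_base_quotients B by blast
  then interpret N: group_nbhd_base G "quotients ` \<B>" .
  have sc: "second_countable N.base_topology"
  proof (rule N.second_countable_base_topology)
    show "countable (quotients ` \<B>)" using B(1) by simp
    fix Q assume "Q \<in> quotients ` \<B>"
    then obtain U where U: "U \<in> \<B>" "Q = quotients U" by blast
    note oU = open_base_at_oneD[OF B(2) U(1)]
    then obtain F where "F \<subseteq> carrier G" "countable F" "carrier G \<subseteq> F <#> U"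
      using assms(2) unfolding omega_narrow_def by (metis le_inf_iff)
    \<comment> \<open>Narrowness passes from \<open>U\<close> to the larger set
      \<open>U U\<^sup>-\<^sup>1\<close> with the same \<open>F\<close>.\<close>
    moreover have "F <#> U \<subseteq> F <#> Q"
      using subset_quotients[OF oU(3,2)] U(2) by (intro mono_set_mult) auto
    ultimately show "\<exists>F. F \<subseteq> carrier G \<and> countable F \<and> carrier G \<subseteq> F <#> Q" by blast
  qed
  have t1: "t1_space N.base_topology"
  proof (rule N.t1_space_base_topology)
    fix x assume "x \<in> carrier G" "x \<noteq> \<one>"
    then obtain U where "U \<in> \<B>" "x \<notin> quotients U"
      by (rule Hausdorff_imp_quotients_separate[OF B(2) assms(1)])
    then show "\<exists>Q\<in>quotients ` \<B>. x \<notin> Q" by blast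
  qed
  \<comment> \<open>Complete regularity is reached through normality: second countability gives the
    Lindelof property, and a regular Lindelof space is normal.\<close>
  have "normal_space N.base_topology"
    using N.regular_space_base_topology sc
    by (intro regular_Lindelof_imp_normal_space second_countable_imp_Lindelof_space)
  with t1 have "Tychonoff_space N.base_topology"
    using normal_imp_completely_regular_space[of N.base_topology] N.regular_space_base_topology
    by (simp add: Tychonoff_space_def)
  with N.topological_group_base_topology show ?thesis
    using sc continuous_map_id_base_topology[OF B(2) N] by (rule that)
qed

end

section \<open>Passage to a plain monoid record\<close>

text \<open>The target group must have type \<open>'a monoid\<close>, while \<open>G\<close> may
  carry extra record fields. Truncation drops them and keeps carrier, product and unit, which
  together determine the inverse.\<close>

lemma topological_group_truncate:
  fixes G :: "('a, 'b) monoid_scheme"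
  assumes "topological_group G \<sigma>"
  shows "topological_group (monoid.truncate G) \<sigma>"
proof -
  interpret topological_group G \<sigma> by (rule assms)
  have sel: "carrier (monoid.truncate G) = carrier G" "mult (monoid.truncate G) = mult G"
    "one (monoid.truncate G) = one G"
    by (simp_all add: monoid.truncate_def)
  then have inv: "m_inv (monoid.truncate G) = m_inv G"
    by (simp add: fun_eq_iff m_inv_def)
  have "group (monoid.truncate G)"
  proof (rule groupI, unfold sel)
    show "\<exists>y\<in>carrier G. y \<otimes>\<^bsub>G\<^esub> x = \<one>\<^bsub>G\<^esub>" if "x \<in> carrier G" for x
      using that by (rule l_inv_ex)
  qed (simp_all add: m_assoc)
  then show ?thesis
    using topspace_eq_carrier continuous_mult continuous_inv
    by (intro topological_group.intro paratopological_group.intro topological_group_axioms.intro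
        paratopological_group_axioms.intro) (simp_all only: sel inv)
qed

theorem corollary3p12:
  fixes G :: "('a, 'b) monoid_scheme" and \<tau> :: "'a topology"
  assumes "paratopological_group G \<tau>"
    and "Hausdorff_space \<tau>"
    and "omega_narrow G \<tau>"
    and "first_countable \<tau>"
    and "SIN_group G \<tau>"
  shows "\<exists>(H :: 'a monoid) (\<sigma> :: 'a topology) \<phi>.
    topological_group H \<sigma> \<and> Tychonoff_space \<sigma> \<and> second_countable \<sigma> \<and>
    continuous_isomorphism G \<tau> H \<sigma> \<phi>"
proof -
  obtain \<sigma> where "topological_group G \<sigma>" "Tychonoff_space \<sigma>" "second_countable \<sigma>"
    "continuous_map \<tau> \<sigma> id"
    by (rule paratopological_group.coarser_second_countable_group_topology[OF assms])
  \<comment> \<open>Carrier and product are those of \<open>G\<close>, so the identity is an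
    isomorphism.\<close>
  moreover have "id \<in> iso G (monoid.truncate G)"
    by (simp add: iso_def hom_def monoid.truncate_def)
  ultimately have "topological_group (monoid.truncate G) \<sigma> \<and> Tychonoff_space \<sigma> \<and>
      second_countable \<sigma> \<and> continuous_isomorphism G \<tau> (monoid.truncate G) \<sigma> id"
    by (simp add: topological_group_truncate continuous_isomorphism_def)
  then show ?thesis by (intro exI)
qed

end
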